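(* Fix a positive integer $h$, let $\sigma(\vec x)=\sum_{i=1}^h x_i$ and $\pi(\vec x)=\prod_{i=1}^h x_i$, and let $k$ be a positive integer. Then $\mathcal{T}_{\mathbb{N}}(\sigma,k)=\mathcal{T}_{\mathbb{N}}(\pi,k)$. In particular, $\mathcal{R}_{\mathbb{N}}(\sigma,k)=\mathcal{R}_{\mathbb{N}}(\pi,k)$.
   Context: $\mathbb{N}$ denotes the positive integers and $[k]=\{1,\dots,k\}$. For a function $\varphi:\mathbb{R}^h\to\mathbb{R}$ and a set $A=\{a_1<\dots<a_k\}\subseteq\mathbb{R}$, the type of the $\varphi$-table of $A$ is the equivalence relation on $[k]^h$ given by $\vec x\equiv\vec y$ if and only if $\varphi(a_{x_1},\dots,a_{x_h})=\varphi(a_{y_1},\dots,a_{y_h})$. For $X\subseteq\mathbb{R}$, $\mathcal{T}_X(\varphi,k)$ is the set of all such types arising from sets $A\subseteq X$ with $|A|=k$. Also $\varphi A=\{\varphi(\vec g):\vec g\in A^h\}$ (the set of values of $\varphi$ on $h$-tuples of elements of $A$) and $\mathcal{R}_X(\varphi,k)=\{|\varphi A| : A\subseteq X,\ |A|=k\}$. *)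

theory Defs
  imports Complex_Main "HOL-Library.FuncSet"
begin

text \<open>
  An \<open>h\<close>-tuple over \<open>S\<close> is an extensional function from the index set \<open>{1..h}\<close> to \<open>S\<close>,
  so that equality of tuples is equality of their \<open>h\<close> entries. A function
  \<open>\<phi>\<close> on \<open>h\<close>-tuples of reals has type \<open>(nat \<Rightarrow> real) \<Rightarrow> real\<close> and is
  only ever applied to elements of \<open>tuples h UNIV\<close>.
\<close>

abbreviation tuples :: "nat \<Rightarrow> 'a set \<Rightarrow> (nat \<Rightarrow> 'a) set" where
  "tuples h S \<equiv> {1..h} \<rightarrow>\<^sub>E S"

text \<open>Indexing is 1-based: for finite \<open>A\<close>, \<open>nth_elem A 1 < \<dots> < nth_elem A (card A)\<close>.\<close>

definition nth_elem :: "real set \<Rightarrow> nat \<Rightarrow> real" where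
  "nth_elem A j = sorted_list_of_set A ! (j - 1)"

definition select :: "nat \<Rightarrow> real set \<Rightarrow> (nat \<Rightarrow> nat) \<Rightarrow> (nat \<Rightarrow> real)" where
  "select h A x = (\<lambda>i\<in>{1..h}. nth_elem A (x i))"

definition table_type ::
    "nat \<Rightarrow> ((nat \<Rightarrow> real) \<Rightarrow> real) \<Rightarrow> real set \<Rightarrow> ((nat \<Rightarrow> nat) \<times> (nat \<Rightarrow> nat)) set" where
  "table_type h \<phi> A =
     {(x, y). x \<in> tuples h {1..card A} \<and> y \<in> tuples h {1..card A} \<and>
              \<phi> (select h A x) = \<phi> (select h A y)}"

definition table_types ::
    "real set \<Rightarrow> nat \<Rightarrow> ((nat \<Rightarrow> real) \<Rightarrow> real) \<Rightarrow> nat \<Rightarrow> ((nat \<Rightarrow> nat) \<times> (nat \<Rightarrow> nat)) set set" where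
  "table_types X h \<phi> k = {table_type h \<phi> A |A. A \<subseteq> X \<and> finite A \<and> card A = k}"

definition value_set :: "nat \<Rightarrow> ((nat \<Rightarrow> real) \<Rightarrow> real) \<Rightarrow> real set \<Rightarrow> real set" where
  "value_set h \<phi> A = \<phi> ` tuples h A"

definition value_counts :: "real set \<Rightarrow> nat \<Rightarrow> ((nat \<Rightarrow> real) \<Rightarrow> real) \<Rightarrow> nat \<Rightarrow> nat set" where
  "value_counts X h \<phi> k = {card (value_set h \<phi> A) |A. A \<subseteq> X \<and> finite A \<and> card A = k}"

definition sum_fun :: "nat \<Rightarrow> (nat \<Rightarrow> real) \<Rightarrow> real" where
  "sum_fun h x = (\<Sum>i=1..h. x i)"

definition prod_fun :: "nat \<Rightarrow> (nat \<Rightarrow> real) \<Rightarrow> real" where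
  "prod_fun h x = (\<Prod>i=1..h. x i)"

definition pos_nats :: "real set" where
  "pos_nats = {real n |n. n \<ge> 1}"

end

theory Submission
  imports Defs "HOL-Computational_Algebra.Primes" "HOL-Real_Asymp.Real_Asymp"
begin

text \<open>
  Exponentiation \<open>a \<mapsto> 2\<^sup>a\<close> turns sums into products and preserves order, which gives one
  inclusion. For the other, \<open>ln n\<close> is the sum of \<open>ln p\<close> over the prime factors \<open>p\<close> of \<open>n\<close>;
  replacing \<open>ln p\<close> by \<open>\<lfloor>N ln p\<rfloor>\<close> gives a completely additive integer-valued function \<open>g\<close> with
  \<open>g n / N \<rightarrow> ln n\<close>. For large \<open>N\<close> it is strictly increasing on any prescribed finite set, in
  particular on \<open>A\<close> and on the set of \<open>h\<close>-fold products from \<open>A\<close>. Then \<open>a \<mapsto> g a + 1\<close> turns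
  the multiplication table of \<open>A\<close> into an addition table of the same type; the shift by 1 keeps the
  values positive (\<open>g 1 = 0\<close>) and adds \<open>h\<close> to every sum.
\<close>

section \<open>Tables and their types\<close>

lemma bij_betw_nth_elem:
  assumes "finite A"
  shows "bij_betw (nth_elem A) {1..card A} A"
proof -
  have "bij_betw (\<lambda>j. j - 1) {1..card A} {..<card A}"
    by (rule bij_betw_byWitness[where f' = Suc]) auto
  moreover have "bij_betw ((!) (sorted_list_of_set A)) {..<card A} A"
    using assms by (intro bij_betw_nth) auto
  ultimately have "bij_betw ((!) (sorted_list_of_set A) \<circ> (\<lambda>j. j - 1)) {1..card A} A"
    by (rule bij_betw_trans)
  then show ?thesis
    by (simp add: nth_elem_def[abs_def] comp_def)
qed

text \<open>Mapping \<open>f\<close> over the increasing enumeration of \<open>A\<close> gives a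
  strictly sorted list, and such a list is determined by its set of elements.\<close>

lemma nth_elem_image:
  assumes "finite A" and f: "strict_mono_on A f" and j: "j \<in> {1..card A}"
  shows "nth_elem (f ` A) j = f (nth_elem A j)"
proof -
  have "sorted_wrt (<) (map f (sorted_list_of_set A))"
    unfolding sorted_wrt_map
    by (rule sorted_wrt_mono_rel[OF _ strict_sorted_list_of_set])
       (use assms in \<open>auto simp: strict_mono_on_def\<close>)
  then have "sorted_list_of_set (f ` A) = map f (sorted_list_of_set A)"
    using sorted_list_of_set.idem_if_sorted_distinct[of "map f (sorted_list_of_set A)"] assms(1)
    by (simp add: strict_sorted_iff)
  then show ?thesis
    using j by (auto simp: nth_elem_def)
qed

lemma image_select_tuples:
  assumes "finite A"
  shows "select h A ` tuples h {1..card A} = tuples h A"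
proof (intro equalityI subsetI)
  fix u assume "u \<in> select h A ` tuples h {1..card A}"
  then obtain x where x: "x \<in> tuples h {1..card A}" and u: "u = select h A x"
    by blast
  show "u \<in> tuples h A"
    unfolding u select_def
    by (intro restrict_PiE_iff[THEN iffD2] ballI bij_betw_apply[OF bij_betw_nth_elem[OF assms]]
        PiE_mem[OF x])
next
  fix u assume u: "u \<in> tuples h A"
  define x where "x = (\<lambda>i\<in>{1..h}. the_inv_into {1..card A} (nth_elem A) (u i))"
  note b = bij_betw_nth_elem[OF assms]
  have "x \<in> tuples h {1..card A}"
    unfolding x_def
    by (intro restrict_PiE_iff[THEN iffD2] ballI bij_betw_apply[OF bij_betw_the_inv_into[OF b]]
        PiE_mem[OF u])
  \<comment> \<open>Inside \<open>{1..h}\<close> the inverse of the enumeration cancels; outside,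
    both functions are \<open>undefined\<close>.\<close>
  moreover have "select h A x = u"
    using f_the_inv_into_f_bij_betw[OF b PiE_mem[OF u]] PiE_arb[OF u]
    by (auto simp: x_def select_def fun_eq_iff)
  ultimately show "u \<in> select h A ` tuples h {1..card A}"
    by blast
qed

text \<open>A strictly increasing \<open>f\<close> keeps every element at its position, so both
  tables carry the same index tuples and only the coincidences between values have to be
  compared.\<close>

lemma table_type_image:
  assumes "finite A" and f: "strict_mono_on A f"
    and eq: "\<And>u v. u \<in> tuples h A \<Longrightarrow> v \<in> tuples h A \<Longrightarrow>
      \<psi> (\<lambda>i\<in>{1..h}. f (u i)) = \<psi> (\<lambda>i\<in>{1..h}. f (v i)) \<longleftrightarrow> \<phi> u = \<phi> v"
  shows "table_type h \<psi> (f ` A) = table_type h \<phi> A"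
proof -
  have card: "card (f ` A) = card A"
    using f by (intro card_image strict_mono_on_imp_inj_on)
  have sel: "select h (f ` A) x = (\<lambda>i\<in>{1..h}. f (select h A x i))"
    if "x \<in> tuples h {1..card A}" for x
    using nth_elem_image[OF assms(1,2) PiE_mem[OF that]] by (auto simp: select_def fun_eq_iff)
  have mem: "select h A x \<in> tuples h A" if "x \<in> tuples h {1..card A}" for x
    using image_select_tuples[OF assms(1)] that by blast
  show ?thesis
    unfolding table_type_def card
    by (intro Collect_cong prod.case_cong refl conj_cong) (simp only: sel eq mem)
qed

text \<open>The classes are the nonempty fibres of \<open>f\<close>, one for each value.\<close>

lemma card_quotient_kernel:
  "card (X // {(x, y). x \<in> X \<and> y \<in> X \<and> f x = f y}) = card (f ` X)"
proof -
  have "X // {(x, y). x \<in> X \<and> y \<in> X \<and> f x = f y} = (\<lambda>c. {x \<in> X. c = f x}) ` f ` X"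
    by (auto simp: quotient_def)
  moreover have "inj_on (\<lambda>c. {x \<in> X. c = f x}) (f ` X)"
    by (rule inj_onI) blast
  ultimately show ?thesis
    by (simp add: card_image)
qed

text \<open>The number of values is the number of classes of the type. Hence the value counts depend
  only on the set of types, and the second claim of the theorem follows from the first.\<close>

lemma value_counts_eq:
  "value_counts X h \<phi> k = (\<lambda>E. card (tuples h {1..k} // E)) ` table_types X h \<phi> k"
proof -
  have card: "card (value_set h \<phi> A) = card (tuples h {1..card A} // table_type h \<phi> A)"
    if "finite A" for A
  proof -
    have "value_set h \<phi> A = (\<lambda>x. \<phi> (select h A x)) ` tuples h {1..card A}"
      unfolding value_set_def by (simp only: image_select_tuples[OF that, symmetric] image_image)
    then show ?thesis
      unfolding table_type_def by (simp only: card_quotient_kernel)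
  qed
  have "value_counts X h \<phi> k =
      (\<lambda>A. card (tuples h {1..k} // table_type h \<phi> A)) ` {A. A \<subseteq> X \<and> finite A \<and> card A = k}"
    unfolding value_counts_def setcompr_eq_image by (rule image_cong) (use card in auto)
  then show ?thesis
    unfolding table_types_def setcompr_eq_image image_image .
qed

text \<open>The map \<open>f\<close> may depend on \<open>A\<close>. The logarithmic direction
  relies on this, since its scale \<open>N\<close> is chosen after \<open>A\<close>.\<close>

lemma table_types_image_subset:
  assumes "\<And>A. A \<subseteq> X \<Longrightarrow> finite A \<Longrightarrow> \<exists>f. strict_mono_on A f \<and> f ` A \<subseteq> Y \<and>
      (\<forall>u \<in> tuples h A. \<forall>v \<in> tuples h A.
        \<psi> (\<lambda>i\<in>{1..h}. f (u i)) = \<psi> (\<lambda>i\<in>{1..h}. f (v i)) \<longleftrightarrow> \<phi> u = \<phi> v)"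
  shows "table_types X h \<phi> k \<subseteq> table_types Y h \<psi> k"
proof
  fix T assume "T \<in> table_types X h \<phi> k"
  then obtain A where A: "A \<subseteq> X" "finite A" "card A = k" and T: "T = table_type h \<phi> A"
    by (auto simp: table_types_def)
  obtain f where f: "strict_mono_on A f" "f ` A \<subseteq> Y"
    "\<forall>u \<in> tuples h A. \<forall>v \<in> tuples h A.
        \<psi> (\<lambda>i\<in>{1..h}. f (u i)) = \<psi> (\<lambda>i\<in>{1..h}. f (v i)) \<longleftrightarrow> \<phi> u = \<phi> v"
    using assms[OF A(1,2)] by blast
  have "T = table_type h \<psi> (f ` A)"
    unfolding T by (rule table_type_image[symmetric]) (use A f in auto)
  moreover have "card (f ` A) = k"
    using A(3) f(1) by (simp add: card_image strict_mono_on_imp_inj_on)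
  ultimately show "T \<in> table_types Y h \<psi> k"
    using A(2) f(2) by (auto simp: table_types_def)
qed

section \<open>Additive integer approximations of the logarithm\<close>

text \<open>Rounding happens at each prime, not at \<open>n\<close>, so additivity is exact; the
  price is an error of less than 1 per prime factor, which vanishes after division by
  \<open>N\<close>.\<close>

definition log_approx :: "nat \<Rightarrow> nat \<Rightarrow> nat" where
  "log_approx N n = (\<Sum>p\<in>#prime_factorization n. nat \<lfloor>real N * ln (real p)\<rfloor>)"

lemma log_approx_mult:
  "m > 0 \<Longrightarrow> n > 0 \<Longrightarrow> log_approx N (m * n) = log_approx N m + log_approx N n"
  by (simp add: log_approx_def prime_factorization_mult)

lemma log_approx_prod:
  assumes "finite I" and "\<And>i. i \<in> I \<Longrightarrow> f i > 0"
  shows "log_approx N (\<Prod>i\<in>I. f i) = (\<Sum>i\<in>I. log_approx N (f i))"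
  using assms by (induction I) (auto simp: log_approx_mult prod_pos, simp add: log_approx_def)

lemma tendsto_nat_floor_mult:
  fixes c :: real
  assumes "c \<ge> 0"
  shows "(\<lambda>N. real (nat \<lfloor>real N * c\<rfloor>) / real N) \<longlonglongrightarrow> c"
proof (rule tendsto_sandwich)
  show "(\<lambda>N. c - 1 / real N) \<longlonglongrightarrow> c"
    by real_asymp
  show "\<forall>\<^sub>F N in sequentially. c - 1 / real N \<le> real (nat \<lfloor>real N * c\<rfloor>) / real N"
    using eventually_gt_at_top[of 0]
  proof eventually_elim
    case (elim N)
    have "real N * c - 1 \<le> real (nat \<lfloor>real N * c\<rfloor>)"
      by linarith
    then show ?case
      using elim by (simp add: pos_le_divide_eq left_diff_distrib) (simp add: mult.commute)
  qed
  show "\<forall>\<^sub>F N in sequentially. real (nat \<lfloor>real N * c\<rfloor>) / real N \<le> c"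
    using eventually_gt_at_top[of 0]
  proof eventually_elim
    case (elim N)
    have "real (nat \<lfloor>real N * c\<rfloor>) \<le> real N * c"
      using assms by simp
    then show ?case
      using elim by (simp add: field_simps)
  qed
qed auto

lemma ln_conv_prime_factorization:
  fixes n :: nat
  assumes "n > 0"
  shows "ln (real n) = (\<Sum>p\<in>#prime_factorization n. ln (real p))"
proof -
  \<comment> \<open>Generalised to arbitrary zero-free multisets so that induction applies;
    primality plays a part only in excluding 0.\<close>
  have "ln (real (prod_mset M)) = (\<Sum>p\<in>#M. ln (real p))" if "0 \<notin># M" for M :: "nat multiset"
    using that
  proof (induction M)
    case (add p M)
    then have "p > 0" "prod_mset M > 0"
      by (auto simp: prod_mset_zero_iff intro!: gr0I)
    with add show ?case
      by (simp add: ln_mult)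
  qed auto
  moreover have "0 \<notin># prime_factorization n"
    by (auto dest: in_prime_factors_imp_prime)
  ultimately show ?thesis
    using assms by (metis prod_mset_prime_factorization_nat)
qed

lemma tendsto_log_approx:
  assumes "n > 0"
  shows "(\<lambda>N. real (log_approx N n) / real N) \<longlonglongrightarrow> ln (real n)"
proof -
  have "(\<lambda>N. real (\<Sum>p\<in>#M. nat \<lfloor>real N * ln (real p)\<rfloor>) / real N)
      \<longlonglongrightarrow> (\<Sum>p\<in>#M. ln (real p))" if "0 \<notin># M" for M
    using that
  proof (induction M)
    case (add p M)
    then have "(\<lambda>N. real (nat \<lfloor>real N * ln (real p)\<rfloor>) / real N) \<longlonglongrightarrow> ln (real p)"
      by (intro tendsto_nat_floor_mult ln_ge_zero) (cases p; simp)
    from tendsto_add[OF this add.IH] add.prems show ?case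
      by (simp add: add_divide_distrib)
  qed auto
  moreover have "0 \<notin># prime_factorization n"
    by (auto dest: in_prime_factors_imp_prime)
  ultimately show ?thesis
    using ln_conv_prime_factorization[OF assms] by (simp add: log_approx_def)
qed

text \<open>For each pair m < n the scaled difference tends to ln n - ln m > 0, so it is eventually
  positive; finitely many pairs then share a common \<open>N\<close>.\<close>

lemma ex_log_approx_strict_mono_on:
  assumes "finite S" and "0 \<notin> S"
  shows "\<exists>N. strict_mono_on S (log_approx N)"
proof -
  have "\<forall>\<^sub>F N in sequentially. m < n \<longrightarrow> log_approx N m < log_approx N n"
    if "m \<in> S" "n \<in> S" for m n
  proof (cases "m < n")
    case True
    have pos: "m > 0" "n > 0"
      using that assms(2) by (auto intro!: gr0I)
    have "\<forall>\<^sub>F N in sequentially. 0 < real (log_approx N n) / real N - real (log_approx N m) / real N"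
      using True pos
      by (intro order_tendstoD(1)[OF tendsto_diff[OF tendsto_log_approx tendsto_log_approx]]) auto
    then show ?thesis
      \<comment> \<open>At \<open>N = 0\<close> both quotients are 0, so the strict inequality
        itself forces \<open>N > 0\<close> and the denominator cancels.\<close>
      by eventually_elim (simp add: divide_less_cancel)
  qed simp
  then have "\<forall>\<^sub>F N in sequentially. \<forall>m\<in>S. \<forall>n\<in>S. m < n \<longrightarrow> log_approx N m < log_approx N n"
    using assms(1) by (simp add: eventually_ball_finite)
  then show ?thesis
    unfolding strict_mono_on_def
    using eventually_happens'[OF sequentially_bot] by blast
qed

section \<open>Addition and multiplication tables\<close>

lemma exp_transfers_sum_to_prod:
  assumes "A \<subseteq> pos_nats"
  shows "\<exists>f. strict_mono_on A f \<and> f ` A \<subseteq> pos_nats \<and>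
      (\<forall>u \<in> tuples h A. \<forall>v \<in> tuples h A.
        prod_fun h (\<lambda>i\<in>{1..h}. f (u i)) = prod_fun h (\<lambda>i\<in>{1..h}. f (v i))
        \<longleftrightarrow> sum_fun h u = sum_fun h v)"
proof (intro exI conjI ballI)
  let ?f = "\<lambda>x::real. 2 powr x"
  show "strict_mono_on A ?f"
    by (auto simp: strict_mono_on_def)
  show "?f ` A \<subseteq> pos_nats"
  proof clarify
    fix a assume "a \<in> A"
    then obtain n where "a = real n"
      using assms by (auto simp: pos_nats_def)
    then have "?f a = real (2 ^ n)"
      by (simp add: powr_realpow)
    then show "?f a \<in> pos_nats"
      unfolding pos_nats_def by (metis (mono_tags) mem_Collect_eq one_le_numeral one_le_power)
  qed
  have "prod_fun h (\<lambda>i\<in>{1..h}. ?f (u i)) = ?f (sum_fun h u)" for u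
    by (simp add: prod_fun_def sum_fun_def powr_sum)
  then show "prod_fun h (\<lambda>i\<in>{1..h}. ?f (u i)) = prod_fun h (\<lambda>i\<in>{1..h}. ?f (v i))
      \<longleftrightarrow> sum_fun h u = sum_fun h v" for u v
    by (simp only:) (simp add: powr_inj)
qed

lemma log_approx_transfers_prod_to_sum:
  assumes "A \<subseteq> pos_nats" and "finite A"
  shows "\<exists>f. strict_mono_on A f \<and> f ` A \<subseteq> pos_nats \<and>
      (\<forall>u \<in> tuples h A. \<forall>v \<in> tuples h A.
        sum_fun h (\<lambda>i\<in>{1..h}. f (u i)) = sum_fun h (\<lambda>i\<in>{1..h}. f (v i))
        \<longleftrightarrow> prod_fun h u = prod_fun h v)"
proof -
  let ?r = "\<lambda>x::real. nat \<lfloor>x\<rfloor>"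
  define P where "P u = (\<Prod>i=1..h. ?r (u i))" for u
  have real_r: "real (?r a) = a" "?r a > 0" if "a \<in> A" for a
    using that assms(1) by (auto simp: pos_nats_def)
  have P_pos: "P u > 0" if "u \<in> tuples h A" for u
    unfolding P_def using real_r(2) PiE_mem[OF that] by (intro prod_pos) blast
  \<comment> \<open>One \<open>N\<close> has to serve two purposes: monotonicity on \<open>A\<close>
    makes \<open>f\<close> increasing, and injectivity on the products makes equal sums force equal
    products. Elements of \<open>A\<close> need not be such products, hence the union.\<close>
  have "finite (?r ` A \<union> P ` tuples h A)"
    using assms(2) by (auto intro!: finite_PiE)
  moreover have "0 \<notin> ?r ` A \<union> P ` tuples h A"
    using real_r(2) P_pos by fastforce
  ultimately obtain N where N: "strict_mono_on (?r ` A \<union> P ` tuples h A) (log_approx N)"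
    using ex_log_approx_strict_mono_on by blast
  define f where "f x = real (log_approx N (?r x) + 1)" for x
  have "strict_mono_on A f"
  proof (rule strict_mono_onI)
    fix a b assume ab: "a \<in> A" "b \<in> A" "a < b"
    then have "?r a < ?r b"
      using real_r(1) by (metis of_nat_less_iff)
    then show "f a < f b"
      using N ab by (auto simp: f_def strict_mono_on_def)
  qed
  moreover have "f ` A \<subseteq> pos_nats"
    by (force simp: f_def pos_nats_def)
  moreover have "sum_fun h (\<lambda>i\<in>{1..h}. f (u i)) = sum_fun h (\<lambda>i\<in>{1..h}. f (v i))
      \<longleftrightarrow> prod_fun h u = prod_fun h v" if uv: "u \<in> tuples h A" "v \<in> tuples h A" for u v
  proof -
    have sum: "sum_fun h (\<lambda>i\<in>{1..h}. f (w i)) = real (log_approx N (P w) + h)"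
      if w: "w \<in> tuples h A" for w
    proof -
      have "log_approx N (P w) = (\<Sum>i=1..h. log_approx N (?r (w i)))"
        unfolding P_def using real_r(2) PiE_mem[OF w] by (intro log_approx_prod) auto
      then show ?thesis
        by (simp add: sum_fun_def f_def sum.distrib)
    qed
    have prod: "prod_fun h w = real (P w)" if w: "w \<in> tuples h A" for w
      unfolding prod_fun_def P_def of_nat_prod
      using real_r(1) PiE_mem[OF w] by (intro prod.cong) auto
    have "log_approx N (P u) = log_approx N (P v) \<longleftrightarrow> P u = P v"
      using strict_mono_on_imp_inj_on[OF N] uv by (intro inj_on_eq_iff) auto
    then show ?thesis
      using sum prod uv by simp
  qed
  ultimately show ?thesis
    by blast
qed

theorem theorem4:
  fixes h k :: nat
  assumes "h \<ge> 1" and "k \<ge> 1"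
  shows "table_types pos_nats h (sum_fun h) k = table_types pos_nats h (prod_fun h) k
       \<and> value_counts pos_nats h (sum_fun h) k = value_counts pos_nats h (prod_fun h) k"
proof -
  have "table_types pos_nats h (sum_fun h) k = table_types pos_nats h (prod_fun h) k"
    by (intro equalityI table_types_image_subset exp_transfers_sum_to_prod
        log_approx_transfers_prod_to_sum)
  then show ?thesis
    by (simp add: value_counts_eq)
qed

end
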